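(* Let $p$ be a prime and $f:\mathbb{F}_{p^n}\to\mathbb{F}_p$ a cubic function (algebraic degree $3$). Then $f$ is bent if and only if $f$ is cubic-like bent, i.e. for every $a\in\mathbb{F}_{p^n}^*$ there exists $b\in\mathbb{F}_{p^n}$ such that $D_{a,b}f(x)=f(x+a+b)-f(x+a)-f(x+b)+f(x)$ is a nonzero constant function.
   Context: Let $\omega=e^{2\pi i/p}$ and $\mathrm{Tr}_n$ the absolute trace of $\mathbb{F}_{p^n}$. The Walsh transform of $g:\mathbb{F}_{p^n}\to\mathbb{F}_p$ is $W_g(y)=\sum_{x\in\mathbb{F}_{p^n}}\omega^{g(x)-\mathrm{Tr}_n(xy)}$. $f$ is bent if $|W_f(y)|^2=p^n$ for all $y$. The algebraic degree is the degree of the algebraic normal form (polynomial in coordinates over $\mathbb{F}_p$ with exponents less than $p$). *)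

theory Defs
  imports Complex_Main "Berlekamp_Zassenhaus.Finite_Field"
begin

text \<open>
  The prime field \<open>F\<^sub>p\<close> is the type \<open>'p mod_ring\<close> with \<open>'p :: prime_card\<close>, so that \<open>p = CARD('p)\<close>;
  the field \<open>F\<^sub>q\<close>, \<open>q = p\<^sup>n\<close>, is a type \<open>'a :: finite_field\<close> with \<open>CARD('a) = CARD('p) ^ n\<close>.
\<close>

text \<open>The inclusion of \<open>F\<^sub>p\<close>; it is a ring homomorphism if \<open>CHAR('a) = CARD('p)\<close>.\<close>

definition fp_embed :: "'p::prime_card mod_ring \<Rightarrow> 'a::finite_field" where
  "fp_embed c = of_int (to_int_mod_ring c)"

definition fp_scale :: "'p::prime_card mod_ring \<Rightarrow> 'a::finite_field \<Rightarrow> 'a" where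
  "fp_scale c x = fp_embed c * x"

definition abs_trace :: "nat \<Rightarrow> 'a::finite_field \<Rightarrow> 'p::prime_card mod_ring" where
  "abs_trace n x = (THE c. fp_embed c = (\<Sum>i<n. x ^ (CARD('p) ^ i)))"

definition omega_pow :: "'p::prime_card mod_ring \<Rightarrow> complex" where
  "omega_pow c = exp (2 * of_real pi * \<i> / of_nat CARD('p)) powi to_int_mod_ring c"

definition walsh :: "nat \<Rightarrow> ('a::finite_field \<Rightarrow> 'p::prime_card mod_ring) \<Rightarrow> 'a \<Rightarrow> complex" where
  "walsh n g y = (\<Sum>x\<in>UNIV. omega_pow (g x - abs_trace n (x * y)))"

definition bent :: "nat \<Rightarrow> ('a::finite_field \<Rightarrow> 'p::prime_card mod_ring) \<Rightarrow> bool" where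
  "bent n f \<longleftrightarrow> (\<forall>y. (cmod (walsh n f y))\<^sup>2 = of_nat (CARD('p) ^ n))"

definition second_derivative ::
    "'a::finite_field \<Rightarrow> 'a \<Rightarrow> ('a \<Rightarrow> 'p::prime_card mod_ring) \<Rightarrow> 'a \<Rightarrow> 'p mod_ring" where
  "second_derivative a b f x = f (x + a + b) - f (x + a) - f (x + b) + f x"

definition cubic_like_bent :: "('a::finite_field \<Rightarrow> 'p::prime_card mod_ring) \<Rightarrow> bool" where
  "cubic_like_bent f \<longleftrightarrow>
     (\<forall>a. a \<noteq> 0 \<longrightarrow> (\<exists>b. \<exists>c. c \<noteq> 0 \<and> (\<forall>x. second_derivative a b f x = c)))"

text \<open>
  Algebraic normal form with respect to the coordinates given by an \<open>F\<^sub>p\<close>-basis \<open>B\<close> of the field.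
  A monomial is an exponent function \<open>e\<close> on \<open>B\<close>, extended by \<open>0\<close> outside of \<open>B\<close>.
\<close>

definition fp_basis :: "'p::prime_card itself \<Rightarrow> 'a::finite_field set \<Rightarrow> bool" where
  "fp_basis _ B \<longleftrightarrow>
     \<not> module.dependent (fp_scale :: 'p mod_ring \<Rightarrow> 'a \<Rightarrow> 'a) B \<and>
     module.span (fp_scale :: 'p mod_ring \<Rightarrow> 'a \<Rightarrow> 'a) B = UNIV"

definition coord :: "'a::finite_field set \<Rightarrow> 'a \<Rightarrow> 'a \<Rightarrow> 'p::prime_card mod_ring" where
  "coord B x b = module.representation fp_scale B x b"

definition anf_exponents :: "'p::prime_card itself \<Rightarrow> 'a::finite_field set \<Rightarrow> ('a \<Rightarrow> nat) set" where
  "anf_exponents _ B = {e. (\<forall>b\<in>B. e b < CARD('p)) \<and> (\<forall>b. b \<notin> B \<longrightarrow> e b = 0)}"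

definition anf_monomial :: "'a::finite_field set \<Rightarrow> ('a \<Rightarrow> nat) \<Rightarrow> 'a \<Rightarrow> 'p::prime_card mod_ring" where
  "anf_monomial B e x = (\<Prod>b\<in>B. coord B x b ^ e b)"

definition is_anf ::
    "'a::finite_field set \<Rightarrow> ('a \<Rightarrow> 'p::prime_card mod_ring) \<Rightarrow> (('a \<Rightarrow> nat) \<Rightarrow> 'p mod_ring) \<Rightarrow> bool" where
  "is_anf B f c \<longleftrightarrow>
     (\<forall>e. e \<notin> anf_exponents TYPE('p) B \<longrightarrow> c e = 0) \<and>
     (\<forall>x. f x = (\<Sum>e\<in>anf_exponents TYPE('p) B. c e * anf_monomial B e x))"

definition anf :: "'a::finite_field set \<Rightarrow> ('a \<Rightarrow> 'p::prime_card mod_ring) \<Rightarrow> ('a \<Rightarrow> nat) \<Rightarrow> 'p mod_ring" where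
  "anf B f = (THE c. is_anf B f c)"

text \<open>The zero function gets degree \<open>0\<close>.\<close>

definition anf_degree :: "'a::finite_field set \<Rightarrow> ('a \<Rightarrow> 'p::prime_card mod_ring) \<Rightarrow> nat" where
  "anf_degree B f = Max (insert 0 {(\<Sum>b\<in>B. e b) | e. anf B f e \<noteq> 0})"

text \<open>The choice of the basis is immaterial, see \<open>algebraic_degree_eq\<close> below.\<close>

definition algebraic_degree :: "('a::finite_field \<Rightarrow> 'p::prime_card mod_ring) \<Rightarrow> nat" where
  "algebraic_degree f = anf_degree (SOME B. fp_basis TYPE('p) B) f"

subsection \<open>Well-definedness\<close>

lemma CHAR_eq_if_card_eq_power:
  assumes "CARD('a::finite_field) = CARD('p::prime_card) ^ n"
  shows "CHAR('a) = CARD('p)"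
proof -
  have "CHAR('a) dvd CARD('p) ^ n"
    using CHAR_dvd_CARD[where ?'a = 'a] assms by simp
  then have "CHAR('a) dvd CARD('p)"
    using prime_dvd_power[OF CHAR_prime] by blast
  then show ?thesis
    using primes_dvd_imp_eq[OF CHAR_prime[where ?'a = 'a] prime_card[where ?'a = 'p]] by blast
qed

locale fp_extension =
  fixes ty_a :: "'a::finite_field itself" and ty_p :: "'p::prime_card itself"
  assumes char_eq: "CHAR('a) = CARD('p)"
begin

lemma fp_embed_of_int: "fp_embed (of_int k :: 'p mod_ring) = (of_int k :: 'a)"
proof -
  have "to_int_mod_ring (of_int k :: 'p mod_ring) = k mod int CARD('p)"
    by (transfer) simp
  then show ?thesis
    by (simp add: fp_embed_def flip: char_eq)
qed

lemma mod_ring_of_int: "\<exists>k. (c :: 'p mod_ring) = of_int k"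
  by (metis of_int_mod_ring_to_int_mod_ring of_int_of_int_mod_ring)

lemma fp_embed_add: "fp_embed (c + d :: 'p mod_ring) = (fp_embed c + fp_embed d :: 'a)"
  using mod_ring_of_int[of c] mod_ring_of_int[of d]
  by (metis fp_embed_of_int of_int_add)

lemma fp_embed_mult: "fp_embed (c * d :: 'p mod_ring) = (fp_embed c * fp_embed d :: 'a)"
  using mod_ring_of_int[of c] mod_ring_of_int[of d]
  by (metis fp_embed_of_int of_int_mult)

lemma fp_embed_1: "fp_embed (1 :: 'p mod_ring) = (1 :: 'a)"
  using fp_embed_of_int[of 1] by simp

lemma fp_embed_0: "fp_embed (0 :: 'p mod_ring) = (0 :: 'a)"
  using fp_embed_of_int[of 0] by simp

lemma fp_embed_power: "fp_embed (c ^ k :: 'p mod_ring) = (fp_embed c ^ k :: 'a)"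
  by (induction k) (simp_all add: fp_embed_1 fp_embed_mult)

lemma inj_fp_embed: "inj (fp_embed :: 'p mod_ring \<Rightarrow> 'a)"
proof (rule injI)
  fix c d :: "'p mod_ring"
  assume eq: "(fp_embed c :: 'a) = fp_embed d"
  obtain e where e: "c = d + e" by (metis diff_add_cancel add.commute)
  with eq have 0: "(fp_embed e :: 'a) = 0" by (simp add: fp_embed_add)
  show "c = d"
  proof (rule ccontr)
    assume "c \<noteq> d"
    then have "e * inverse e = 1" using e by simp
    then have "(fp_embed e :: 'a) * fp_embed (inverse e) = 1"
      by (metis fp_embed_1 fp_embed_mult)
    then show False using 0 by simp
  qed
qed

lemma mod_ring_power_card: "(c :: 'p mod_ring) ^ CARD('p) = c"
  using finite_field_power_card_eq_same[of c] by simp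

lemma mod_ring_power_card_minus_1: "(c :: 'p mod_ring) \<noteq> 0 \<Longrightarrow> c ^ (CARD('p) - 1) = 1"
proof -
  assume c: "c \<noteq> 0"
  have "CARD('p) > 0" by simp
  then have "c * c ^ (CARD('p) - 1) = c"
    by (metis mod_ring_power_card power_eq_if less_numeral_extra(3))
  then show ?thesis using c by (metis mult_cancel_left1)
qed

lemma range_fp_embed: "range (fp_embed :: 'p mod_ring \<Rightarrow> 'a) = {x. x ^ CARD('p) = x}"
proof (rule card_seteq)
  let ?q = "monom 1 CARD('p) - [:0, 1:] :: 'a poly"
  have p1: "CARD('p) > 1" using prime_card prime_gt_1_nat by blast
  have deg: "degree ?q = CARD('p)"
  proof -
    have "degree (monom (1 :: 'a) CARD('p)) = CARD('p)" by (simp add: degree_monom_eq)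
    then show ?thesis using p1 by (subst diff_conv_add_uminus, subst degree_add_eq_left) simp_all
  qed
  then have nz: "?q \<noteq> 0" using p1 by auto
  have set: "{x. x ^ CARD('p) = x} = {x. poly ?q x = 0}" by (auto simp: poly_monom)
  show "finite {x :: 'a. x ^ CARD('p) = x}" by simp
  show "range (fp_embed :: 'p mod_ring \<Rightarrow> 'a) \<subseteq> {x. x ^ CARD('p) = x}"
    by (auto simp: mod_ring_power_card simp flip: fp_embed_power)
  have "card (range (fp_embed :: 'p mod_ring \<Rightarrow> 'a)) = CARD('p)"
    by (simp add: card_image[OF inj_fp_embed])
  then show "card {x :: 'a. x ^ CARD('p) = x} \<le> card (range (fp_embed :: 'p mod_ring \<Rightarrow> 'a))"
    using card_poly_roots_bound[OF nz] deg set by simp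
qed

lemma sum_power_card: "(\<Sum>i\<in>I. h i :: 'a) ^ CARD('p) = (\<Sum>i\<in>I. h i ^ CARD('p))"
  by (rule freshmans_dream_sum) (simp_all add: prime_card char_eq)

lemma fp_embed_abs_trace:
  assumes "CARD('a) = CARD('p) ^ n"
  shows "fp_embed (abs_trace n x :: 'p mod_ring) = (\<Sum>i<n. (x :: 'a) ^ (CARD('p) ^ i))"
proof -
  let ?t = "\<Sum>i<n. x ^ (CARD('p) ^ i)"
  have "?t ^ CARD('p) = (\<Sum>i<n. x ^ (CARD('p) ^ Suc i))"
    by (simp add: sum_power_card power_mult [symmetric] mult.commute)
  also have "\<dots> + x = (\<Sum>i<Suc n. x ^ (CARD('p) ^ i))"
    by (subst sum.lessThan_Suc_shift) simp
  also have "\<dots> = ?t + x"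
    using finite_field_power_card_eq_same[of x] assms by simp
  finally have "?t \<in> range (fp_embed :: 'p mod_ring \<Rightarrow> 'a)"
    unfolding range_fp_embed by simp
  then have "\<exists>!c :: 'p mod_ring. fp_embed c = ?t"
    using inj_fp_embed by (metis (mono_tags, lifting) imageE injD)
  then show ?thesis unfolding abs_trace_def by (rule theI')
qed

sublocale fp: vector_space "fp_scale :: 'p mod_ring \<Rightarrow> 'a \<Rightarrow> 'a"
  by standard
    (simp_all add: fp_scale_def fp_embed_add fp_embed_mult fp_embed_1 algebra_simps)

lemma fp_basis_exists: "\<exists>B :: 'a set. fp_basis TYPE('p) B"
  using fp.independent_extend_basis[OF fp.independent_empty]
    fp.span_extend_basis[OF fp.independent_empty]
  unfolding fp_basis_def by blast

context
  fixes B :: "'a set"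
  assumes B: "fp_basis TYPE('p) B"
begin

private lemma indep: "fp.independent B" and span: "x \<in> fp.span B"
  using B by (auto simp: fp_basis_def)

lemma coord_add: "(coord B (x + y) b :: 'p mod_ring) = coord B x b + coord B y b"
  unfolding coord_def by (simp add: fp.representation_add[OF indep span span])

lemma coord_scale: "(coord B (fp_scale c x) b :: 'p mod_ring) = c * coord B x b"
  unfolding coord_def by (simp add: fp.representation_scale[OF indep span])

lemma coord_sum: "(coord B (\<Sum>i\<in>I. h i) b :: 'p mod_ring) = (\<Sum>i\<in>I. coord B (h i) b)"
  unfolding coord_def by (simp add: fp.representation_sum[OF indep span])

lemma sum_coord: "(\<Sum>b\<in>B. fp_scale (coord B x b :: 'p mod_ring) b) = x"
  unfolding coord_def by (rule fp.sum_representation_eq) (use indep span in auto)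

lemma coord_basis: "b' \<in> B \<Longrightarrow> (coord B b' b :: 'p mod_ring) = (if b = b' then 1 else 0)"
  unfolding coord_def by (simp add: fp.representation_basis[OF indep])

lemma coord_outside: "b \<notin> B \<Longrightarrow> (coord B x b :: 'p mod_ring) = 0"
  unfolding coord_def using fp.representation_ne_zero by blast

lemma finite_exps: "finite (anf_exponents TYPE('p) B)"
proof -
  have "anf_exponents TYPE('p) B \<subseteq> (\<lambda>g b. if b \<in> B then g b else 0) ` (B \<rightarrow>\<^sub>E {..<CARD('p)})"
  proof
    fix e assume e: "e \<in> anf_exponents TYPE('p) B"
    show "e \<in> (\<lambda>g b. if b \<in> B then g b else 0) ` (B \<rightarrow>\<^sub>E {..<CARD('p)})"
      by (rule image_eqI[of _ _ "restrict e B"]) (use e in \<open>auto simp: anf_exponents_def fun_eq_iff\<close>)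
  qed
  then show ?thesis by (rule finite_subset) (simp add: finite_PiE)
qed

text \<open>Functions with a representation of degree at most \<open>d\<close>.\<close>

definition deg_le :: "nat \<Rightarrow> ('a \<Rightarrow> 'p mod_ring) \<Rightarrow> bool" where
  "deg_le d f \<longleftrightarrow> (\<exists>c. (\<forall>e. c e \<noteq> 0 \<longrightarrow> e \<in> anf_exponents TYPE('p) B \<and> sum e B \<le> d) \<and>
     (\<forall>x. f x = (\<Sum>e\<in>anf_exponents TYPE('p) B. c e * anf_monomial B e x)))"

lemma deg_le_mono: "deg_le d f \<Longrightarrow> d \<le> d' \<Longrightarrow> deg_le d' f"
  unfolding deg_le_def by (meson le_trans)

lemma deg_le_0: "deg_le d (\<lambda>x. 0)"
  unfolding deg_le_def by (rule exI[of _ "\<lambda>e. 0"]) simp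

lemma deg_le_add:
  assumes "deg_le d f" "deg_le d g"
  shows "deg_le d (\<lambda>x. f x + g x)"
proof -
  obtain c c' where
    "\<forall>e. c e \<noteq> 0 \<longrightarrow> e \<in> anf_exponents TYPE('p) B \<and> sum e B \<le> d"
    "\<forall>x. f x = (\<Sum>e\<in>anf_exponents TYPE('p) B. c e * anf_monomial B e x)"
    "\<forall>e. c' e \<noteq> 0 \<longrightarrow> e \<in> anf_exponents TYPE('p) B \<and> sum e B \<le> d"
    "\<forall>x. g x = (\<Sum>e\<in>anf_exponents TYPE('p) B. c' e * anf_monomial B e x)"
    using assms unfolding deg_le_def by blast
  then show ?thesis
    unfolding deg_le_def
    by (intro exI[of _ "\<lambda>e. c e + c' e"] conjI allI impI)
      (metis add.right_neutral, metis add.right_neutral, simp add: distrib_right sum.distrib)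
qed

lemma deg_le_scale:
  assumes "deg_le d f"
  shows "deg_le d (\<lambda>x. k * f x)"
proof -
  obtain c where
    "\<forall>e. c e \<noteq> 0 \<longrightarrow> e \<in> anf_exponents TYPE('p) B \<and> sum e B \<le> d"
    "\<forall>x. f x = (\<Sum>e\<in>anf_exponents TYPE('p) B. c e * anf_monomial B e x)"
    using assms unfolding deg_le_def by blast
  then show ?thesis
    unfolding deg_le_def
    by (intro exI[of _ "\<lambda>e. k * c e"]) (auto simp: sum_distrib_left mult.assoc)
qed

lemma deg_le_sum:
  "(\<And>i. i \<in> I \<Longrightarrow> deg_le d (h i)) \<Longrightarrow> deg_le d (\<lambda>x. \<Sum>i\<in>I. h i x)"
  by (induction I rule: infinite_finite_induct) (auto intro: deg_le_0 deg_le_add)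

lemma deg_le_monomial:
  assumes "e \<in> anf_exponents TYPE('p) B" "sum e B \<le> d"
  shows "deg_le d (anf_monomial B e)"
  unfolding deg_le_def
proof (intro exI[of _ "\<lambda>e'. if e' = e then 1 else 0"] conjI allI impI)
  fix x
  have "(\<Sum>e'\<in>anf_exponents TYPE('p) B. (if e' = e then 1 else 0) * anf_monomial B e' x) =
        (\<Sum>e'\<in>anf_exponents TYPE('p) B. if e' = e then anf_monomial B e' x else (0 :: 'p mod_ring))"
    by (rule sum.cong) auto
  then show "(anf_monomial B e x :: 'p mod_ring) =
      (\<Sum>e'\<in>anf_exponents TYPE('p) B. (if e' = e then 1 else 0) * anf_monomial B e' x)"
    using assms finite_exps by simp
qed (use assms in \<open>auto split: if_splits\<close>)

lemma deg_le_const: "deg_le d (\<lambda>x. k)"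
proof -
  have "(\<lambda>_. 0) \<in> anf_exponents TYPE('p) B"
    by (auto simp: anf_exponents_def)
  from deg_le_monomial[OF this, of d] have "deg_le d (\<lambda>x. 1)"
    by (simp add: anf_monomial_def [abs_def])
  from deg_le_scale[OF this, of k] show ?thesis by simp
qed

lemma coord_times_monomial:
  assumes b: "b \<in> B" and e: "e \<in> anf_exponents TYPE('p) B"
  shows "deg_le (Suc (sum e B)) (\<lambda>x. coord B x b * anf_monomial B e x)"
proof -
  have p1: "CARD('p) > 1" using prime_card prime_gt_1_nat by blast
  define r where "r = (if Suc (e b) = CARD('p) then 1 else Suc (e b))"
  let ?e = "e(b := r)"
  have lt: "e b < CARD('p)" using b e by (auto simp: anf_exponents_def)
  have "?e \<in> anf_exponents TYPE('p) B"
    using b e lt p1 by (auto simp: anf_exponents_def r_def)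
  moreover have "sum ?e B \<le> Suc (sum e B)"
    using b by (simp add: sum.remove[of B b] r_def)
  moreover have "anf_monomial B ?e x = coord B x b * (anf_monomial B e x :: 'p mod_ring)" for x
  proof -
    have "(coord B x b :: 'p mod_ring) ^ r = coord B x b ^ Suc (e b)"
      using mod_ring_power_card by (auto simp: r_def simp del: power_Suc)
    then show ?thesis
      using b by (simp add: anf_monomial_def prod.remove[of B b])
  qed
  ultimately show ?thesis
    using deg_le_monomial[of ?e "Suc (sum e B)"] by presburger
qed

lemma deg_le_coord_times:
  assumes "deg_le d f" "b \<in> B"
  shows "deg_le (Suc d) (\<lambda>x. coord B x b * f x)"
proof -
  obtain c where c: "\<And>e. c e \<noteq> 0 \<Longrightarrow> e \<in> anf_exponents TYPE('p) B \<and> sum e B \<le> d"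
    and f: "\<And>x. f x = (\<Sum>e\<in>anf_exponents TYPE('p) B. c e * anf_monomial B e x)"
    using assms(1) unfolding deg_le_def by blast
  have "deg_le (Suc d) (\<lambda>x. c e * (coord B x b * anf_monomial B e x))"
    if e: "e \<in> anf_exponents TYPE('p) B" for e
  proof (cases "c e = 0")
    case False
    show ?thesis
      by (rule deg_le_scale, rule deg_le_mono[OF coord_times_monomial[OF assms(2) e]])
        (use c False in auto)
  qed (simp add: deg_le_0)
  then have "deg_le (Suc d) (\<lambda>x. \<Sum>e\<in>anf_exponents TYPE('p) B.
      c e * (coord B x b * anf_monomial B e x))"
    by (rule deg_le_sum)
  then show ?thesis
    by (simp add: f sum_distrib_left mult_ac)
qed

lemma deg_le_linear_times:
  assumes f: "deg_le d f" and l: "\<And>x. l x = (\<Sum>b\<in>B. t b * coord B x b)"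
  shows "deg_le (Suc d) (\<lambda>x. l x * f x)"
proof -
  have "deg_le (Suc d) (\<lambda>x. \<Sum>b\<in>B. t b * (coord B x b * f x))"
    by (intro deg_le_sum deg_le_scale deg_le_coord_times f)
  then show ?thesis by (simp add: l sum_distrib_right mult.assoc)
qed

lemma deg_le_indicator: "\<exists>d. deg_le d (\<lambda>x. if x = a then 1 else 0)"
proof -
  have affine: "\<exists>d. deg_le d (\<lambda>x. (coord B x b - s) * g x)" if "b \<in> B" "\<exists>d. deg_le d g" for b s g
  proof -
    from that(2) obtain d where d: "deg_le d g" by blast
    have "deg_le (Suc d) (\<lambda>x. coord B x b * g x + (- s) * g x)"
      by (intro deg_le_add deg_le_coord_times[OF d \<open>b \<in> B\<close>] deg_le_scale
          deg_le_mono[OF d]) simp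
    then show ?thesis by (auto simp: algebra_simps)
  qed
  have power: "\<exists>d. deg_le d (\<lambda>x. (coord B x b - s) ^ k * g x)"
    if "b \<in> B" "\<exists>d. deg_le d g" for b s g k
  proof (induction k)
    case (Suc k)
    from affine[OF that(1) Suc] show ?case by (simp add: mult.assoc)
  qed (use that(2) in simp)
  have factor: "\<exists>d. deg_le d (\<lambda>x. (1 - (coord B x b - s) ^ k) * g x)"
    if b: "b \<in> B" and g: "\<exists>d. deg_le d g" for b s g k
  proof -
    from power[OF that] obtain d1 where d1: "deg_le d1 (\<lambda>x. (coord B x b - s) ^ k * g x)" by blast
    from g obtain d2 where d2: "deg_le d2 g" by blast
    have "deg_le (max d1 d2) (\<lambda>x. g x + (- 1) * ((coord B x b - s) ^ k * g x))"
      by (intro deg_le_add deg_le_scale deg_le_mono[OF d1] deg_le_mono[OF d2]) simp_all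
    then show ?thesis by (auto simp: algebra_simps)
  qed
  have prod: "\<exists>d. deg_le d (\<lambda>x. \<Prod>b\<in>A. 1 - (coord B x b - coord B a b) ^ (CARD('p) - 1))"
    if "A \<subseteq> B" for A
    using finite_subset[OF that finite] that
  proof (induction A rule: finite_induct)
    case (insert b A)
    then show ?case using factor[of b] by simp
  qed (use deg_le_const in auto)
  have "(\<Prod>b\<in>B. 1 - (coord B x b - coord B a b :: 'p mod_ring) ^ (CARD('p) - 1)) =
      (if x = a then 1 else 0)" for x
  proof (cases "x = a")
    case True
    have "CARD('p) > 1" using prime_card prime_gt_1_nat by blast
    then show ?thesis using True by (simp add: zero_power)
  next
    case False
    then obtain b where "b \<in> B" "(coord B x b :: 'p mod_ring) \<noteq> coord B a b"
      by (metis (no_types, lifting) sum.cong sum_coord)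
    then show ?thesis
      using False mod_ring_power_card_minus_1[of "coord B x b - coord B a b"] by (auto intro!: prod_zero)
  qed
  then show ?thesis using prod[of B] by simp
qed

lemma deg_le_exists: "\<exists>d. deg_le d f"
proof -
  obtain d where d: "\<And>a. deg_le (d a) (\<lambda>x. if x = a then 1 else 0)"
    using deg_le_indicator by metis
  have "deg_le (Max (range d)) (\<lambda>x. \<Sum>a\<in>UNIV. f a * (if x = a then 1 else 0))"
    by (intro deg_le_sum deg_le_scale deg_le_mono[OF d]) simp
  then show ?thesis by (auto simp: if_distrib cong: if_cong)
qed

lemma is_anf_exists: "\<exists>c. is_anf B f c"
  for f :: "'a \<Rightarrow> 'p mod_ring"
  using deg_le_exists[of f] unfolding deg_le_def is_anf_def by metis

lemma bij_exponents: "\<exists>\<phi>. bij_betw \<phi> (UNIV :: 'a set) (anf_exponents TYPE('p) B)"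
proof -
  define \<phi> where "\<phi> x b = nat (to_int_mod_ring (coord B x b :: 'p mod_ring))" for x b
  define \<psi> where "\<psi> e = (\<Sum>b\<in>B. fp_scale (of_nat (e b) :: 'p mod_ring) b)" for e
  have rng: "to_int_mod_ring (c :: 'p mod_ring) \<in> {0..<int CARD('p)}" for c
    using range_to_int_mod_ring[where ?'a = 'p] by blast
  have of_nat_nat: "of_nat (nat (to_int_mod_ring c)) = (c :: 'p mod_ring)" for c
    using rng[of c] by (simp add: of_nat_of_int_mod_ring)
  have "bij_betw \<phi> (UNIV :: 'a set) (anf_exponents TYPE('p) B)"
  proof (rule bij_betwI[where g = \<psi>])
    show "\<phi> \<in> UNIV \<rightarrow> anf_exponents TYPE('p) B"
      using rng by (auto simp: anf_exponents_def \<phi>_def coord_outside nat_less_iff)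
    show "\<psi> (\<phi> x) = x" for x
      by (simp add: \<phi>_def \<psi>_def of_nat_nat sum_coord)
    show "\<phi> (\<psi> e) = e" if e: "e \<in> anf_exponents TYPE('p) B" for e
    proof
      fix b
      have "(coord B (\<psi> e) b :: 'p mod_ring) = (\<Sum>b'\<in>B. of_nat (e b') * (if b = b' then 1 else 0))"
        unfolding \<psi>_def coord_sum by (intro sum.cong refl) (simp add: coord_scale coord_basis)
      also have "\<dots> = of_nat (e b)"
        using e by (auto simp: if_distrib anf_exponents_def cong: if_cong)
      finally have *: "(coord B (\<psi> e) b :: 'p mod_ring) = of_nat (e b)" .
      have "e b < CARD('p)"
        using e by (cases "b \<in> B") (auto simp: anf_exponents_def)
      then show "\<phi> (\<psi> e) b = e b"
        by (simp add: \<phi>_def * of_nat_of_int_mod_ring)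
    qed
  qed simp
  then show ?thesis by blast
qed

lemma is_anf_unique:
  fixes f :: "'a \<Rightarrow> 'p mod_ring"
  assumes "is_anf B f c" "is_anf B f c'"
  shows "c = c'"
proof -
  obtain \<phi> where \<phi>: "bij_betw \<phi> (UNIV :: 'a set) (anf_exponents TYPE('p) B)"
    using bij_exponents by blast
  define H :: "('a \<Rightarrow> 'p mod_ring) \<Rightarrow> 'a \<Rightarrow> 'p mod_ring" where
    "H u x = (\<Sum>y\<in>UNIV. u y * anf_monomial B (\<phi> y) x)" for u x
  have H: "H (c \<circ> \<phi>) = g" if "is_anf B g c" for g c
  proof
    fix x
    show "H (c \<circ> \<phi>) x = g x"
      using that sum.reindex_bij_betw[OF \<phi>, of "\<lambda>e. c e * anf_monomial B e x"]
      unfolding is_anf_def H_def by simp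
  qed
  have "\<exists>u. H u = g" for g
    using H is_anf_exists[of g] by blast
  then have "surj H" unfolding surj_def by metis
  then have "inj H" by (simp add: finite_UNIV_surj_inj)
  moreover have "H (c \<circ> \<phi>) = H (c' \<circ> \<phi>)" using H assms by simp
  ultimately have eq: "c \<circ> \<phi> = c' \<circ> \<phi>" by (simp add: inj_eq)
  show ?thesis
  proof
    fix e
    show "c e = c' e"
    proof (cases "e \<in> anf_exponents TYPE('p) B")
      case True
      then obtain y where "e = \<phi> y" using \<phi> by (auto simp: bij_betw_def)
      then show ?thesis using eq by (metis comp_apply)
    qed (use assms in \<open>simp add: is_anf_def\<close>)
  qed
qed

lemma is_anf_anf: "is_anf B f (anf B f)"
  for f :: "'a \<Rightarrow> 'p mod_ring"
proof -
  obtain c where c: "is_anf B f c" using is_anf_exists by blast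
  show ?thesis
    unfolding anf_def
  proof (rule theI[where P = "is_anf B f"])
    show "is_anf B f c" by (fact c)
    show "c' = c" if "is_anf B f c'" for c'
      by (rule is_anf_unique[OF that c])
  qed
qed

lemma anf_support: "anf B f e \<noteq> 0 \<Longrightarrow> e \<in> anf_exponents TYPE('p) B"
  for f :: "'a \<Rightarrow> 'p mod_ring"
  using is_anf_anf unfolding is_anf_def by blast

lemma anf_degree_le_iff: "anf_degree B f \<le> d \<longleftrightarrow> deg_le d f"
  for f :: "'a \<Rightarrow> 'p mod_ring"
proof -
  have "{sum e B | e. anf B f e \<noteq> 0} \<subseteq> (\<lambda>e. sum e B) ` anf_exponents TYPE('p) B"
    using anf_support by blast
  then have fin: "finite {sum e B | e. anf B f e \<noteq> 0}"
    using finite_exps finite_surj by blast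
  have 1: "anf_degree B f \<le> d \<longleftrightarrow> (\<forall>e. anf B f e \<noteq> 0 \<longrightarrow> sum e B \<le> d)"
    unfolding anf_degree_def using fin by auto
  show ?thesis
  proof
    assume "anf_degree B f \<le> d"
    with 1 show "deg_le d f"
      using is_anf_anf[of f] anf_support unfolding deg_le_def is_anf_def
      by (intro exI[of _ "anf B f"]) auto
  next
    assume "deg_le d f"
    then obtain c where c: "\<And>e. c e \<noteq> 0 \<Longrightarrow> e \<in> anf_exponents TYPE('p) B \<and> sum e B \<le> d"
      and "\<And>x. f x = (\<Sum>e\<in>anf_exponents TYPE('p) B. c e * anf_monomial B e x)"
      unfolding deg_le_def by blast
    then have "is_anf B f c" unfolding is_anf_def by blast
    then have "c = anf B f" using is_anf_unique is_anf_anf by blast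
    then show "anf_degree B f \<le> d" using 1 c by blast
  qed
qed

end

lemma anf_degree_mono_basis:
  fixes f :: "'a \<Rightarrow> 'p mod_ring"
  assumes B: "fp_basis TYPE('p) B" and B': "fp_basis TYPE('p) B'"
  shows "anf_degree B f \<le> anf_degree B' f"
proof -
  have lin: "(coord B' x b' :: 'p mod_ring) = (\<Sum>b\<in>B. coord B' b b' * coord B x b)" for x b'
  proof -
    have "(coord B' x b' :: 'p mod_ring) =
        coord B' (\<Sum>b\<in>B. fp_scale (coord B x b :: 'p mod_ring) b) b'"
      by (simp add: sum_coord[OF B])
    then show ?thesis
      by (simp add: coord_sum[OF B'] coord_scale[OF B'] mult.commute)
  qed
  have pow: "deg_le B (k + d) (\<lambda>x. coord B' x b' ^ k * g x)" if "deg_le B d g" for k d b' g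
  proof (induction k)
    case (Suc k)
    from deg_le_linear_times[OF B this lin] show ?case by (simp add: mult.assoc)
  qed (use that in simp)
  have mono: "deg_le B (sum e A) (\<lambda>x. \<Prod>b\<in>A. coord B' x b ^ e b)" for e A
    using finite[of A]
  proof (induction A rule: finite_induct)
    case (insert b A)
    then show ?case using pow[of "sum e A" _ "e b" b] by simp
  qed (simp add: deg_le_const[OF B])
  have "deg_le B' (anf_degree B' f) f" using anf_degree_le_iff[OF B'] by blast
  then obtain c where c: "\<And>e. c e \<noteq> 0 \<Longrightarrow> e \<in> anf_exponents TYPE('p) B' \<and> sum e B' \<le> anf_degree B' f"
    and f: "\<And>x. f x = (\<Sum>e\<in>anf_exponents TYPE('p) B'. c e * anf_monomial B' e x)"
    unfolding deg_le_def[OF B'] by blast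
  have "deg_le B (anf_degree B' f) (\<lambda>x. c e * anf_monomial B' e x)" for e
  proof (cases "c e = 0")
    case False
    then show ?thesis
      unfolding anf_monomial_def
      by (intro deg_le_scale[OF B] deg_le_mono[OF B mono]) (use c in blast)
  qed (simp add: deg_le_0[OF B])
  then have "deg_le B (anf_degree B' f) (\<lambda>x. \<Sum>e\<in>anf_exponents TYPE('p) B'. c e * anf_monomial B' e x)"
    by (intro deg_le_sum[OF B])
  then have "deg_le B (anf_degree B' f) f" by (simp flip: f)
  then show ?thesis using anf_degree_le_iff[OF B] by blast
qed

end

theorem algebraic_degree_eq:
  fixes f :: "'a::finite_field \<Rightarrow> 'p::prime_card mod_ring"
  assumes "CARD('a) = CARD('p) ^ n" and B: "fp_basis TYPE('p) B"
  shows "algebraic_degree f = anf_degree B f"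
proof -
  interpret fp_extension "TYPE('a)" "TYPE('p)"
    by standard (rule CHAR_eq_if_card_eq_power[OF assms(1)])
  have "fp_basis TYPE('p) (SOME B :: 'a set. fp_basis TYPE('p) B)"
    using fp_basis_exists by (rule someI_ex)
  then show ?thesis
    unfolding algebraic_degree_def using B by (intro antisym anf_degree_mono_basis)
qed

theorem is_anf_iff_anf:
  fixes f :: "'a::finite_field \<Rightarrow> 'p::prime_card mod_ring"
  assumes "CARD('a) = CARD('p) ^ n" and B: "fp_basis TYPE('p) B"
  shows "is_anf B f c \<longleftrightarrow> c = anf B f"
proof -
  interpret fp_extension "TYPE('a)" "TYPE('p)"
    by standard (rule CHAR_eq_if_card_eq_power[OF assms(1)])
  show ?thesis using is_anf_anf[OF B] is_anf_unique[OF B] by blast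
qed

end

theory Submission
  imports Defs "HOL-Analysis.Complex_Transcendental"
begin

text \<open>
  Write \<open>S g = \<Sum>\<^sub>x \<omega>\<^bsup>g x\<^esup>\<close> and \<open>D\<^sub>a g x = g (x + a) - g x\<close>. Then \<open>|S g|\<^sup>2 = \<Sum>\<^sub>a S (D\<^sub>a g)\<close>, and
  \<open>S g = 0\<close> as soon as some \<open>D\<^sub>b g\<close> is a nonzero constant, since translation by \<open>b\<close> multiplies \<open>S g\<close>
  by a nontrivial root of unity.
  By Fourier inversion, \<open>f\<close> is bent iff \<open>S (D\<^sub>a f) = 0\<close> for all \<open>a \<noteq> 0\<close>.
  If \<open>f\<close> is cubic, \<open>g = D\<^sub>a f\<close> is at most quadratic, so each \<open>D\<^sub>b g\<close> is affine and \<open>S (D\<^sub>b g)\<close>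
  vanishes unless \<open>D\<^sub>b g\<close> is constant. If no \<open>D\<^sub>b g\<close> is a nonzero constant, then \<open>|S g|\<^sup>2\<close> is a sum of
  nonnegative terms, and the term for \<open>b = 0\<close> is positive.
\<close>

subsection \<open>Finite differences\<close>

definition difference :: "'a::ab_group_add \<Rightarrow> ('a \<Rightarrow> 'b::ab_group_add) \<Rightarrow> 'a \<Rightarrow> 'b" where
  "difference a g x = g (x + a) - g x"

text \<open>A coordinate-free consequence of having degree less than \<open>k\<close>. The index is
  one above the degree, so that \<open>0\<close> singles out the zero function and inductions start
  there.\<close>

fun differences_vanish :: "nat \<Rightarrow> ('a::ab_group_add \<Rightarrow> 'b::ab_group_add) \<Rightarrow> bool" where
  "differences_vanish 0 g \<longleftrightarrow> (\<forall>x. g x = 0)"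
| "differences_vanish (Suc k) g \<longleftrightarrow> (\<forall>a. differences_vanish k (difference a g))"

lemma differences_vanish_zero: "differences_vanish k (\<lambda>x. 0)"
  by (induction k) (simp_all add: difference_def [abs_def])

lemma differences_vanish_const: "differences_vanish (Suc k) (\<lambda>x. c)"
  using differences_vanish_zero by (simp add: difference_def [abs_def])

lemma differences_vanish_add:
  "differences_vanish k g \<Longrightarrow> differences_vanish k h \<Longrightarrow> differences_vanish k (\<lambda>x. g x + h x)"
proof (induction k arbitrary: g h)
  case (Suc k)
  have "difference a (\<lambda>x. g x + h x) = (\<lambda>x. difference a g x + difference a h x)" for a
    by (simp add: difference_def fun_eq_iff)
  then show ?case using Suc by simp
qed simp

lemma differences_vanish_sum:
  "(\<And>i. i \<in> I \<Longrightarrow> differences_vanish k (h i)) \<Longrightarrow> differences_vanish k (\<lambda>x. \<Sum>i\<in>I. h i x)"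
  by (induction I rule: infinite_finite_induct)
    (auto intro: differences_vanish_zero differences_vanish_add)

lemma differences_vanish_scale:
  fixes g :: "'a::ab_group_add \<Rightarrow> 'b::comm_ring"
  shows "differences_vanish k g \<Longrightarrow> differences_vanish k (\<lambda>x. c * g x)"
proof (induction k arbitrary: g)
  case (Suc k)
  have "difference a (\<lambda>x. c * g x) = (\<lambda>x. c * difference a g x)" for a
    by (simp add: difference_def fun_eq_iff right_diff_distrib)
  then show ?case using Suc by simp
qed simp

lemma differences_vanish_shift:
  "differences_vanish k g \<Longrightarrow> differences_vanish k (\<lambda>x. g (x + b))"
proof (induction k arbitrary: g)
  case (Suc k)
  have "difference a (\<lambda>x. g (x + b)) = (\<lambda>x. difference a g (x + b))" for a
    by (simp add: difference_def fun_eq_iff add_ac)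
  then show ?case using Suc by simp
qed simp

lemma differences_vanish_Suc: "differences_vanish k g \<Longrightarrow> differences_vanish (Suc k) g"
proof (induction k arbitrary: g)
  case 0
  then show ?case by (simp add: difference_def)
qed simp

lemma differences_vanish_mono:
  "k \<le> l \<Longrightarrow> differences_vanish k g \<Longrightarrow> differences_vanish l g"
  by (induction rule: dec_induct) (auto intro: differences_vanish_Suc simp del: differences_vanish.simps)

text \<open>A Leibniz rule drives the induction: a difference of \<open>l x * g x\<close> is
  \<open>l x\<close> times a difference of \<open>g\<close>, covered by the induction hypothesis,
  plus the constant \<open>l a\<close> times a translate of \<open>g\<close>.\<close>

lemma differences_vanish_additive_mult:
  fixes g l :: "'a::ab_group_add \<Rightarrow> 'b::comm_ring"
  assumes l: "\<And>x y. l (x + y) = l x + l y"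
  shows "differences_vanish k g \<Longrightarrow> differences_vanish (Suc k) (\<lambda>x. l x * g x)"
proof (induction k arbitrary: g)
  case 0
  then show ?case by (simp add: difference_def)
next
  case (Suc k)
  have leibniz: "difference a (\<lambda>x. l x * g x) = (\<lambda>x. l x * difference a g x + l a * g (x + a))" for a
    by (simp add: difference_def fun_eq_iff l algebra_simps)
  have "differences_vanish (Suc k) (difference a (\<lambda>x. l x * g x))" for a
    unfolding leibniz
    by (intro differences_vanish_add Suc.IH differences_vanish_scale differences_vanish_shift Suc.prems)
      (use Suc.prems in simp)
  then show ?case by simp
qed

text \<open>Coordinates are additive, so a monomial of total degree \<open>s\<close> arises from the
  constant \<open>1\<close> by \<open>s\<close> multiplications with additive maps, each costing one
  more difference.\<close>

lemma (in fp_extension) differences_vanish_if_algebraic_degree_le: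
  fixes f :: "'a \<Rightarrow> 'p mod_ring"
  assumes "algebraic_degree f \<le> d"
  shows "differences_vanish (Suc d) f"
proof -
  \<comment> \<open>This repeats the choice made in \<open>algebraic_degree\<close>, so the degree
    bound transfers to \<open>B\<close> by unfolding.\<close>
  define B :: "'a set" where "B = (SOME B. fp_basis TYPE('p) B)"
  have B: "fp_basis TYPE('p) B"
    unfolding B_def using fp_basis_exists by (rule someI_ex)
  have power: "differences_vanish (k + j) (\<lambda>x. coord B x b ^ k * g x)"
    if "differences_vanish j g" for g :: "'a \<Rightarrow> 'p mod_ring" and k j b
  proof (induction k)
    case (Suc k)
    then show ?case
      using differences_vanish_additive_mult[where l = "\<lambda>x. coord B x b", OF coord_add[OF B] Suc]
      by (simp add: mult.assoc)
  qed (use that in simp)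
  have monomial: "differences_vanish (Suc (sum e A)) (\<lambda>x. \<Prod>b\<in>A. coord B x b ^ e b :: 'p mod_ring)"
    for e A
    using finite[of A]
  proof (induction A rule: finite_induct)
    case empty
    then show ?case using differences_vanish_const[of 0 "1 :: 'p mod_ring"] by simp
  next
    case (insert b A)
    then show ?case using power[OF insert.IH, of "e b" b] by simp
  qed
  have "deg_le B d f"
    using assms anf_degree_le_iff[OF B] unfolding algebraic_degree_def B_def by blast
  then obtain c where c: "\<And>e. c e \<noteq> 0 \<Longrightarrow> sum e B \<le> d"
    and f: "\<And>x. f x = (\<Sum>e\<in>anf_exponents TYPE('p) B. c e * anf_monomial B e x)"
    unfolding deg_le_def[OF B] by blast
  have "differences_vanish (Suc d) (\<lambda>x. c e * anf_monomial B e x)" for e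
  proof (cases "c e = 0")
    case True
    then show ?thesis
      using differences_vanish_zero[where k = "Suc d"] by (simp del: differences_vanish.simps)
  next
    case False
    show ?thesis
      unfolding anf_monomial_def
      by (rule differences_vanish_scale, rule differences_vanish_mono[OF _ monomial])
        (use c[OF False] in simp)
  qed
  then have "differences_vanish (Suc d) (\<lambda>x. \<Sum>e\<in>anf_exponents TYPE('p) B. c e * anf_monomial B e x)"
    by (rule differences_vanish_sum)
  then show ?thesis by (simp only: f [symmetric])
qed

subsection \<open>Exponential sums\<close>

text \<open>Replacing \<open>k mod p\<close> by \<open>k\<close> changes the exponent by an integer
  multiple of 2 pi i. With any integer representative allowed, additivity and conjugation can be
  read off from \<open>exp\<close>.\<close>

lemma omega_pow_of_int:
  "omega_pow (of_int k :: 'p::prime_card mod_ring) = exp (2 * of_real pi * \<i> * of_int k / of_nat CARD('p))"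
proof -
  let ?m = "CARD('p)"
  have "to_int_mod_ring (of_int k :: 'p mod_ring) = k mod int ?m"
    by transfer simp
  then have "omega_pow (of_int k :: 'p mod_ring) = exp (2 * of_real pi * \<i> / of_nat ?m) powi (k mod int ?m)"
    by (simp add: omega_pow_def)
  also have "\<dots> = exp (of_int (k mod int ?m) * (2 * of_real pi * \<i> / of_nat ?m))"
    by (simp add: exp_power_int mult.commute)
  also have "of_int (k mod int ?m) = (of_int k - of_nat ?m * of_int (k div int ?m) :: complex)"
    by (simp flip: minus_mult_div_eq_mod)
  also have "\<dots> * (2 * of_real pi * \<i> / of_nat ?m) =
      2 * of_real pi * \<i> * of_int k / of_nat ?m - 2 * of_real pi * of_int (k div int ?m) * \<i>"
    by (simp add: field_simps)
  also have "exp \<dots> = exp (2 * of_real pi * \<i> * of_int k / of_nat ?m)"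
    using exp_2pi_1_int[of "k div int ?m"] by (subst exp_diff) (simp add: mult_ac del: exp_2pi_1_int)
  finally show ?thesis .
qed

lemma mod_ring_eq_of_int: "\<exists>k. (c :: 'p::prime_card mod_ring) = of_int k"
  by (metis of_int_mod_ring_to_int_mod_ring of_int_of_int_mod_ring)

lemma omega_pow_add: "omega_pow (c + d) = omega_pow c * omega_pow d"
proof -
  obtain k l where kl: "c = of_int k" "d = of_int l"
    using mod_ring_eq_of_int by metis
  have "c + d = of_int (k + l)" by (simp add: kl)
  then show ?thesis
    by (simp only: omega_pow_of_int kl flip: exp_add)
      (simp add: distrib_left add_divide_distrib)
qed

lemma omega_pow_0 [simp]: "omega_pow 0 = 1"
  using omega_pow_of_int[of 0] by simp

lemma cnj_omega_pow: "cnj (omega_pow c) = omega_pow (- c)"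
proof -
  obtain k where k: "c = of_int k" using mod_ring_eq_of_int by metis
  have "- c = of_int (- k)" by (simp add: k)
  then show ?thesis by (simp only: omega_pow_of_int k exp_cnj) simp
qed

lemma omega_pow_eq_1_iff: "omega_pow c = 1 \<longleftrightarrow> c = 0"
  for c :: "'p::prime_card mod_ring"
proof
  assume 1: "omega_pow c = 1"
  obtain k where k: "c = of_int k" using mod_ring_eq_of_int by metis
  from 1 obtain j :: int where "2 * pi * of_int k / of_nat CARD('p) = of_int (2 * j) * pi"
    unfolding k omega_pow_of_int exp_eq_1 by auto
  then have "real_of_int k = of_int (j * int CARD('p))"
    by (simp add: field_simps)
  then have "k = j * int CARD('p)" by (simp only: of_int_eq_iff)
  then show "c = 0" by (simp add: k)
qed simp

definition exp_sum :: "('a::finite \<Rightarrow> 'p::prime_card mod_ring) \<Rightarrow> complex" where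
  "exp_sum g = (\<Sum>x\<in>UNIV. omega_pow (g x))"

lemma sum_translate:
  fixes a :: "'a::{finite,ab_group_add}"
  shows "(\<Sum>x\<in>UNIV. h (x + a)) = (\<Sum>x\<in>UNIV. h x)"
  by (rule sum.reindex_bij_witness[of _ "\<lambda>x. x - a" "\<lambda>x. x + a"]) auto

lemma exp_sum_zero: "(\<And>x. g x = 0) \<Longrightarrow> exp_sum g = of_nat CARD('a)"
  for g :: "'a::finite \<Rightarrow> 'p::prime_card mod_ring"
  by (simp add: exp_sum_def)

lemma exp_sum_shift: "exp_sum (\<lambda>x. g x + c) = exp_sum g * omega_pow c"
  by (simp add: exp_sum_def omega_pow_add sum_distrib_right)

lemma exp_sum_eq_0:
  fixes g :: "'a::{finite,ab_group_add} \<Rightarrow> 'p::prime_card mod_ring"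
  assumes "\<And>x. difference b g x = c" "c \<noteq> 0"
  shows "exp_sum g = 0"
proof -
  have "g (x + b) = g x + c" for x
    using assms(1)[of x] by (simp add: difference_def algebra_simps)
  then have "exp_sum g = exp_sum (\<lambda>x. g x + c)"
    unfolding exp_sum_def using sum_translate[of "\<lambda>x. omega_pow (g x)" b] by simp
  then have "exp_sum g * (omega_pow c - 1) = 0"
    by (simp add: exp_sum_shift)
  then show ?thesis using assms(2) by (simp add: omega_pow_eq_1_iff)
qed

lemma cmod_exp_sum:
  fixes g :: "'a::{finite,ab_group_add} \<Rightarrow> 'p::prime_card mod_ring"
  shows "complex_of_real ((cmod (exp_sum g))\<^sup>2) = (\<Sum>a\<in>UNIV. exp_sum (difference a g))"
proof -
  have "complex_of_real ((cmod (exp_sum g))\<^sup>2) = (\<Sum>x\<in>UNIV. \<Sum>y\<in>UNIV. omega_pow (g y) * omega_pow (- g x))"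
    unfolding complex_norm_square
    by (simp add: exp_sum_def cnj_omega_pow sum_product) (rule sum.swap)
  \<comment> \<open>For each fixed \<open>x\<close> the inner sum is reindexed by
    \<open>y = a + x\<close>, which turns \<open>a\<close> into the direction of a
    difference.\<close>
  also have "\<dots> = (\<Sum>x\<in>UNIV. \<Sum>a\<in>UNIV. omega_pow (g (a + x)) * omega_pow (- g x))"
    by (simp only: sum_translate[of "\<lambda>y. omega_pow (g y) * omega_pow (- g _)"])
  also have "\<dots> = (\<Sum>a\<in>UNIV. \<Sum>x\<in>UNIV. omega_pow (g (x + a)) * omega_pow (- g x))"
    by (subst sum.swap) (simp add: add.commute)
  finally show ?thesis
    by (simp add: exp_sum_def difference_def flip: omega_pow_add)
qed

lemma exp_sum_affine:
  fixes h :: "'a::{finite,ab_group_add} \<Rightarrow> 'p::prime_card mod_ring"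
  assumes "differences_vanish 2 h" "exp_sum h \<noteq> 0"
  shows "h x = h 0"
proof -
  have const: "difference a h y = difference a h 0" for a y
  proof -
    have "difference y (difference a h) 0 = 0"
      using assms(1) by (simp add: numeral_2_eq_2)
    then show ?thesis by (simp add: difference_def)
  qed
  \<comment> \<open>The direction is the point \<open>x\<close> itself: the constant value of
    \<open>difference x h\<close> is \<open>h x - h 0\<close>, and a nonzero value would make the
    exponential sum vanish.\<close>
  have "difference x h 0 = 0"
    using exp_sum_eq_0[OF const] assms(2) by blast
  then show ?thesis by (simp add: difference_def)
qed

lemma exp_sum_quadratic_eq_0_iff:
  fixes g :: "'a::{finite,ab_group_add} \<Rightarrow> 'p::prime_card mod_ring"
  assumes "differences_vanish 3 g"
  shows "exp_sum g = 0 \<longleftrightarrow> (\<exists>b c. c \<noteq> 0 \<and> (\<forall>x. difference b g x = c))"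
proof
  show "exp_sum g = 0" if "\<exists>b c. c \<noteq> 0 \<and> (\<forall>x. difference b g x = c)"
    using that exp_sum_eq_0 by blast
  show "\<exists>b c. c \<noteq> 0 \<and> (\<forall>x. difference b g x = c)" if 0: "exp_sum g = 0"
  proof (rule ccontr)
    assume none: "\<not> ?thesis"
    \<comment> \<open>If the term is nonzero, the affine function \<open>difference b g\<close> is
      constant, and \<open>none\<close> forces the constant to be \<open>0\<close>; the term is then
      \<open>CARD('a)\<close>.\<close>
    have nonneg: "Re (exp_sum (difference b g)) \<ge> 0" for b
    proof (cases "exp_sum (difference b g) = 0")
      case False
      have "differences_vanish 2 (difference b g)"
        using assms by (simp add: numeral_3_eq_3 numeral_2_eq_2)
      from exp_sum_affine[OF this False] have "difference b g x = difference b g 0" for x .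
      with none have "difference b g x = 0" for x by metis
      then show ?thesis by (simp add: exp_sum_zero)
    qed simp
    have "(\<Sum>b\<in>UNIV. exp_sum (difference b g)) = 0"
      using cmod_exp_sum[of g] 0 by simp
    then have "(\<Sum>b\<in>UNIV. Re (exp_sum (difference b g))) = 0"
      by (metis Re_sum zero_complex.sel(1))
    then have "Re (exp_sum (difference 0 g)) = 0"
      using nonneg by (simp add: sum_nonneg_eq_0_iff)
    then show False by (simp add: exp_sum_zero difference_def)
  qed
qed

subsection \<open>The trace and bent functions\<close>

context fp_extension
begin

context
  fixes n :: nat
  assumes card: "CARD('a) = CARD('p) ^ n"
begin

text \<open>The comparison takes place in \<open>'a\<close>, where the trace is a sum of additive
  Frobenius powers; injectivity of \<open>fp_embed\<close> brings it back to the prime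
  field.\<close>

lemma abs_trace_add: "(abs_trace n (x + y :: 'a) :: 'p mod_ring) = abs_trace n x + abs_trace n y"
proof -
  have "(x + y) ^ (CARD('p) ^ i) = x ^ (CARD('p) ^ i) + y ^ (CARD('p) ^ i)" for i
    by (rule freshmans_dream') (simp_all add: prime_card char_eq)
  then have "(fp_embed (abs_trace n (x + y) :: 'p mod_ring) :: 'a) = fp_embed (abs_trace n x + abs_trace n y :: 'p mod_ring)"
    by (simp add: fp_embed_add fp_embed_abs_trace[OF card] sum.distrib)
  then show ?thesis using inj_fp_embed by (simp add: inj_eq)
qed

text \<open>Otherwise all \<open>p ^ n\<close> field elements would be roots of the trace
  polynomial, whose degree is at most \<open>p ^ (n - 1)\<close>.\<close>

lemma abs_trace_nonzero: "\<exists>x :: 'a. (abs_trace n x :: 'p mod_ring) \<noteq> 0"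
proof (rule ccontr)
  assume "\<not> ?thesis"
  then have 0: "(\<Sum>i<n. x ^ (CARD('p) ^ i)) = 0" for x :: 'a
    using fp_embed_abs_trace[OF card, of x] by (simp add: fp_embed_0)
  have p: "CARD('p) > 1" using prime_card prime_gt_1_nat by blast
  have "card {0, 1 :: 'a} \<le> CARD('a)" by (rule card_mono) simp_all
  then have "n \<noteq> 0" using card by (cases n) auto
  let ?q = "\<Sum>i<n. monom (1 :: 'a) (CARD('p) ^ i)"
  \<comment> \<open>Only \<open>i = 0\<close> contributes to the linear coefficient, which is
    therefore exactly \<open>1\<close>; this shows that the polynomial is nonzero.\<close>
  have "CARD('p) ^ i = 1 \<longleftrightarrow> i = 0" for i using p by simp
  then have "coeff ?q 1 = 1" using \<open>n \<noteq> 0\<close> by (simp add: coeff_sum)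
  then have nz: "?q \<noteq> 0" by auto
  have "degree ?q \<le> CARD('p) ^ (n - 1)"
    by (rule degree_sum_le) (use p in \<open>auto simp: degree_monom_eq intro!: power_increasing\<close>)
  also have "\<dots> < CARD('p) ^ n" using p \<open>n \<noteq> 0\<close> by simp
  finally have "degree ?q < CARD('a)" using card by simp
  moreover have "{x. poly ?q x = 0} = UNIV"
    by (simp add: poly_sum poly_monom 0)
  then have "CARD('a) \<le> degree ?q" using card_poly_roots_bound[OF nz] by simp
  ultimately show False by simp
qed

text \<open>Orthogonality of additive characters: shifting \<open>y\<close> by \<open>z / a\<close>
  changes \<open>abs_trace n (a * y)\<close> by \<open>abs_trace n z\<close>, and \<open>z\<close>
  can be chosen with nonzero trace.\<close>

lemma exp_sum_abs_trace:
  assumes "a \<noteq> (0 :: 'a)"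
  shows "exp_sum (\<lambda>y. - abs_trace n (a * y) :: 'p mod_ring) = 0"
proof -
  obtain z :: 'a where z: "(abs_trace n z :: 'p mod_ring) \<noteq> 0"
    using abs_trace_nonzero by blast
  show ?thesis
  proof (rule exp_sum_eq_0)
    show "difference (z / a) (\<lambda>y. - abs_trace n (a * y) :: 'p mod_ring) x = - abs_trace n z" for x
      using assms by (simp add: difference_def distrib_left abs_trace_add)
    show "- abs_trace n z \<noteq> (0 :: 'p mod_ring)" using z by simp
  qed
qed

lemma abs_trace_0: "(abs_trace n (0 :: 'a) :: 'p mod_ring) = 0"
  using abs_trace_add[of 0 0] by (simp only: add_0 add_cancel_right_right)

text \<open>The linear twist in \<open>walsh\<close> alters the difference in direction
  \<open>a\<close> only by the constant \<open>- abs_trace n (a * y)\<close>. The squared modulus is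
  thus the Fourier transform of the autocorrelation of \<open>f\<close>.\<close>

lemma cmod_walsh:
  fixes f :: "'a \<Rightarrow> 'p mod_ring"
  shows "complex_of_real ((cmod (walsh n f y))\<^sup>2) =
    (\<Sum>a\<in>UNIV. exp_sum (difference a f) * omega_pow (- abs_trace n (a * y) :: 'p mod_ring))"
proof -
  have "difference a (\<lambda>x. f x - abs_trace n (x * y)) = (\<lambda>x. difference a f x + - abs_trace n (a * y))" for a
    by (simp add: difference_def fun_eq_iff distrib_right abs_trace_add)
  moreover have "walsh n f y = exp_sum (\<lambda>x. f x - abs_trace n (x * y))"
    by (simp add: walsh_def exp_sum_def)
  ultimately show ?thesis by (simp only: cmod_exp_sum exp_sum_shift)
qed

lemma bent_iff_exp_sum_difference:
  fixes f :: "'a \<Rightarrow> 'p mod_ring"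
  shows "bent n f \<longleftrightarrow> (\<forall>a. a \<noteq> 0 \<longrightarrow> exp_sum (difference a f) = 0)"
proof
  let ?C = "\<lambda>a. exp_sum (difference a f)"
  show "bent n f" if 0: "\<forall>a. a \<noteq> 0 \<longrightarrow> ?C a = 0"
    unfolding bent_def
  proof
    fix y
    have "?C a * omega_pow (- abs_trace n (a * y) :: 'p mod_ring) = (if a = 0 then of_nat CARD('a) else 0)" for a
      using 0 by (simp add: abs_trace_0 exp_sum_zero difference_def)
    then have "complex_of_real ((cmod (walsh n f y))\<^sup>2) = of_real (of_nat CARD('a))"
      unfolding cmod_walsh by simp
    then show "(cmod (walsh n f y))\<^sup>2 = of_nat (CARD('p) ^ n)"
      unfolding of_real_eq_iff card .
  qed
  show "\<forall>a. a \<noteq> 0 \<longrightarrow> ?C a = 0" if bent: "bent n f"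
  proof (intro allI impI)
    fix c :: 'a assume c: "c \<noteq> 0"
    let ?e = "\<lambda>a y :: 'a. omega_pow (- abs_trace n (a * y) :: 'p mod_ring)"
    have e_mult: "?e a y * ?e b y = ?e (a + b) y" for a b y
      by (simp add: distrib_right abs_trace_add flip: omega_pow_add)
    have orth: "(\<Sum>y\<in>UNIV. ?e a y) = (if a = 0 then of_nat CARD('a) else 0)" for a
      using exp_sum_abs_trace[of a] by (simp add: exp_sum_def abs_trace_0)
    have walsh: "complex_of_real ((cmod (walsh n f y))\<^sup>2) = of_nat (CARD('p) ^ n)" for y
      using bent unfolding bent_def by (metis of_real_of_nat_eq)
    \<comment> \<open>The constant squared modulus is paired with the character
      \<open>?e (- c)\<close>, whose sum is \<open>0\<close> as \<open>c \<noteq> 0\<close>.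
      Expanding the modulus by \<open>cmod_walsh\<close> instead leaves only \<open>a = c\<close>,
      by orthogonality.\<close>
    have "0 = of_nat (CARD('p) ^ n) * (\<Sum>y\<in>UNIV. ?e (- c) y)"
      using c by (simp only: orth) simp
    also have "\<dots> = (\<Sum>y\<in>UNIV. complex_of_real ((cmod (walsh n f y))\<^sup>2) * ?e (- c) y)"
      by (simp only: walsh sum_distrib_left)
    also have "\<dots> = (\<Sum>y\<in>UNIV. \<Sum>a\<in>UNIV. ?C a * ?e (a - c) y)"
      by (simp only: cmod_walsh sum_distrib_right mult.assoc e_mult) simp
    also have "\<dots> = (\<Sum>a\<in>UNIV. ?C a * (\<Sum>y\<in>UNIV. ?e (a - c) y))"
      by (subst sum.swap) (simp only: sum_distrib_left)
    also have "\<dots> = (\<Sum>a\<in>UNIV. if a = c then ?C c * of_nat CARD('a) else 0)"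
      by (intro sum.cong refl) (simp only: orth, simp)
    also have "\<dots> = ?C c * of_nat CARD('a)" by simp
    finally show "?C c = 0" by simp
  qed
qed

end

end

theorem theorem3:
  fixes f :: "'a::finite_field \<Rightarrow> 'p::prime_card mod_ring" and n :: nat
  assumes "CARD('a) = CARD('p) ^ n"
    and "algebraic_degree f = 3"
  shows "bent n f \<longleftrightarrow> cubic_like_bent f"
proof -
  interpret fp_extension "TYPE('a)" "TYPE('p)"
    by standard (rule CHAR_eq_if_card_eq_power[OF assms(1)])
  have "differences_vanish (Suc 3) f"
    by (rule differences_vanish_if_algebraic_degree_le) (simp add: assms(2))
  then have quadratic: "differences_vanish 3 (difference a f)" for a
    by (simp only: differences_vanish.simps)
  \<comment> \<open>Hence the pair \<open>b\<close>, \<open>c\<close> required by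
    \<open>cubic_like_bent\<close> at \<open>a\<close> is exactly the one in the vanishing criterion
    for \<open>difference a f\<close>.\<close>
  have "second_derivative a b f x = difference b (difference a f) x" for a b x
    by (simp add: second_derivative_def difference_def algebra_simps)
  then show ?thesis
    unfolding bent_iff_exp_sum_difference[OF assms(1)] cubic_like_bent_def
      exp_sum_quadratic_eq_0_iff[OF quadratic]
    by simp
qed

end
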